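(* Let $\mathcal H$ be a separable Banach space, let $\Psi:\mathcal H\to\mathbb R$ be measurable, let $\mathcal K$ be a Markov transition kernel on $\mathcal H$, and let $\lambda$ be a Radon probability measure on $\mathcal H$. Let $\mathcal P$ be the RCAR-MH kernel built from $(\Psi,\mathcal K,\lambda)$ (see context). Assume: (1) (increasing in the tail) for every $\tilde\beta,\tilde b\in(0,1)$ there exist constants $R_0(\tilde\beta,\tilde b)>0$ and $M_4(\tilde\beta,\tilde b)>0$ such that for all $u\in\mathcal H$ with $\|u\|>R_0$, $$\inf_{v\in B_{\tilde b(1-\tilde\beta)\|u\|}(\tilde\beta u)}\exp(\Psi(u)-\Psi(v))\ge M_4;$$ (2) (almost sure contraction) if $\zeta_u\sim\mathcal K(u,\cdot)$, then $\|\zeta_u\|<\|u\|$ almost surely for every $u\in\mathcal H\setminus\{0\}$, and $\zeta_0=0$ almost surely; (3) (local concentration) there exist constants $0<b_0<\beta_0<1$ and $\epsilon_0>0$ such that for all $u\in\mathcal H$, with $\zeta_u\sim\mathcal K(u,\cdot)$, $\mathbb P[\|\zeta_u-\beta_0u\|\le b_0(1-\beta_0)\|u\|]\ge\epsilon_0$; (4) $\int_{\mathcal H}\|\xi\|^p\,\lambda(d\xi)<\infty$ for an integer $p\ge1$. Then $V(u)=\|u\|^p$ is a Lyapunov function for $\mathcal P$, i.e. there exist $\kappa\in(0,1)$ and $K\in(0,\infty)$ such that $(\mathcal PV)(u)\le\kappa V(u)+K$ for all $u\in\mathcal H$.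
   Context: $B_R(v)$ denotes the closed ball of radius $R$ centered at $v$ in $\mathcal H$, whose norm is $\|\cdot\|$. Given $(\Psi,\mathcal K,\lambda)$, the proposal kernel is $\mathcal Q(u,\cdot):=\mathcal K(u,\cdot)*\lambda$, i.e. the law of $\zeta_u+\xi$ with independent $\zeta_u\sim\mathcal K(u,\cdot)$, $\xi\sim\lambda$; the acceptance ratio is $\alpha(u,v):=1\wedge\exp(\Psi(u)-\Psi(v))$; and the RCAR-MH kernel is $$\mathcal P(u,dv):=\alpha(u,v)\,\mathcal Q(u,dv)+\delta_u(dv)\int_{\mathcal H}(1-\alpha(u,w))\,\mathcal Q(u,dw).$$ For a function $V$, $(\mathcal PV)(u)=\int_{\mathcal H} V(v)\,\mathcal P(u,dv)$. *)

theory Defs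
  imports "HOL-Probability.Probability"
begin

text \<open>Local finiteness, the other half of being Radon, is automatic for probability measures.\<close>

definition radon_prob :: "'a::topological_space measure \<Rightarrow> bool" where
  "radon_prob M \<longleftrightarrow> prob_space M \<and> sets M = sets borel \<and>
     (\<forall>A\<in>sets borel. emeasure M A = (SUP C\<in>{C. C \<subseteq> A \<and> compact C}. emeasure M C))"

definition markov_kernel :: "('a::topological_space \<Rightarrow> 'a measure) \<Rightarrow> bool" where
  "markov_kernel K \<longleftrightarrow> K \<in> borel \<rightarrow>\<^sub>M prob_algebra borel"

text \<open>The convolution of \<^theory>\<open>HOL-Probability.Convolution\<close> is restricted to Euclidean spaces,
  so the law of the independent sum is written out here.\<close>

definition proposal_kernel ::
    "('a::real_normed_vector \<Rightarrow> 'a measure) \<Rightarrow> 'a measure \<Rightarrow> 'a \<Rightarrow> 'a measure" where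
  "proposal_kernel K L u = distr (K u \<Otimes>\<^sub>M L) borel (\<lambda>(\<zeta>, \<xi>). \<zeta> + \<xi>)"

definition acceptance :: "('a \<Rightarrow> real) \<Rightarrow> 'a \<Rightarrow> 'a \<Rightarrow> real" where
  "acceptance \<Psi> u v = min 1 (exp (\<Psi> u - \<Psi> v))"

definition rcar_kernel ::
    "('a::real_normed_vector \<Rightarrow> real) \<Rightarrow> ('a \<Rightarrow> 'a measure) \<Rightarrow> 'a measure \<Rightarrow> 'a \<Rightarrow> 'a measure" where
  "rcar_kernel \<Psi> K L u = measure_of UNIV (sets borel)
     (\<lambda>A. (\<integral>\<^sup>+v\<in>A. ennreal (acceptance \<Psi> u v) \<partial>proposal_kernel K L u)
        + indicator A u * (\<integral>\<^sup>+w. ennreal (1 - acceptance \<Psi> u w) \<partial>proposal_kernel K L u))"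

text \<open>Integrability is required explicitly because the Bochner integral of a non-integrable
  function is 0.\<close>

definition lyapunov_function :: "('a \<Rightarrow> 'a measure) \<Rightarrow> ('a \<Rightarrow> real) \<Rightarrow> bool" where
  "lyapunov_function P V \<longleftrightarrow> (\<exists>\<kappa> C. 0 < \<kappa> \<and> \<kappa> < 1 \<and> 0 < C \<and>
     (\<forall>u. integrable (P u) V \<and> (\<integral>v. V v \<partial>P u) \<le> \<kappa> * V u + C))"

lemma sets_proposal_kernel [simp, measurable_cong]: "sets (proposal_kernel K L u) = sets borel"
  by (simp add: proposal_kernel_def)

lemma sets_rcar_kernel [simp, measurable_cong]: "sets (rcar_kernel \<Psi> K L u) = sets borel"
  unfolding rcar_kernel_def
  using sets.sigma_sets_eq[of borel] sets.space_closed[of borel] by simp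

lemma measurable_acceptance [measurable]:
  assumes [measurable]: "\<Psi> \<in> borel_measurable borel"
  shows "acceptance \<Psi> u \<in> borel_measurable borel"
  unfolding acceptance_def by measurable

text \<open>The set function in the definition of the kernel is indeed a measure.\<close>

lemma emeasure_rcar_kernel:
  assumes [measurable]: "\<Psi> \<in> borel_measurable borel" and A: "A \<in> sets borel"
  shows "emeasure (rcar_kernel \<Psi> K L u) A =
     (\<integral>\<^sup>+v\<in>A. ennreal (acceptance \<Psi> u v) \<partial>proposal_kernel K L u)
     + indicator A u * (\<integral>\<^sup>+w. ennreal (1 - acceptance \<Psi> u w) \<partial>proposal_kernel K L u)"
    (is "_ = ?\<mu> A")
proof -
  let ?Q = "proposal_kernel K L u"
  have "emeasure (density ?Q (\<lambda>v. ennreal (acceptance \<Psi> u v))) B +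
      emeasure (scale_measure (\<integral>\<^sup>+w. ennreal (1 - acceptance \<Psi> u w) \<partial>?Q) (return borel u)) B = ?\<mu> B"
    if "B \<in> sets borel" for B
    using that by (simp add: emeasure_density mult.commute)
  moreover have "countably_additive (sets borel) (\<lambda>B.
      emeasure (density ?Q (\<lambda>v. ennreal (acceptance \<Psi> u v))) B +
      emeasure (scale_measure (\<integral>\<^sup>+w. ennreal (1 - acceptance \<Psi> u w) \<partial>?Q) (return borel u)) B)"
  proof (rule countably_additiveI)
    fix F :: "nat \<Rightarrow> 'a set"
    assume F: "range F \<subseteq> sets borel" "disjoint_family F"
    then show "(\<Sum>i. emeasure (density ?Q (\<lambda>v. ennreal (acceptance \<Psi> u v))) (F i) +
      emeasure (scale_measure (\<integral>\<^sup>+w. ennreal (1 - acceptance \<Psi> u w) \<partial>?Q) (return borel u)) (F i)) =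
      emeasure (density ?Q (\<lambda>v. ennreal (acceptance \<Psi> u v))) (\<Union>i. F i) +
      emeasure (scale_measure (\<integral>\<^sup>+w. ennreal (1 - acceptance \<Psi> u w) \<partial>?Q) (return borel u)) (\<Union>i. F i)"
      by (subst suminf_add[symmetric]) (auto intro!: arg_cong2[where f = "(+)"] suminf_emeasure simp: suminf_indicator)
  qed
  ultimately have ca: "countably_additive (sets borel) ?\<mu>"
    unfolding countably_additive_def by (auto simp: subset_eq)
  have "emeasure (rcar_kernel \<Psi> K L u) A = ?\<mu> A"
  proof (rule emeasure_measure_of[OF rcar_kernel_def])
    show "positive (sets (rcar_kernel \<Psi> K L u)) ?\<mu>" by (simp add: positive_def)
  qed (use A ca in auto)
  then show ?thesis .
qed

lemma prob_space_proposal_kernel: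
  fixes K :: "'a::{banach, second_countable_topology} \<Rightarrow> 'a measure"
  assumes "markov_kernel K" "radon_prob L"
  shows "prob_space (proposal_kernel K L u)"
proof -
  have K: "prob_space (K u)" "sets (K u) = sets borel"
    using measurable_space[OF assms(1)[unfolded markov_kernel_def], of u]
    by (auto simp: space_prob_algebra)
  have L: "prob_space L" "sets L = sets borel"
    using assms(2) by (auto simp: radon_prob_def)
  interpret pair_prob_space "K u" L
    by (simp add: pair_prob_space_def pair_sigma_finite_def prob_space_imp_sigma_finite K L)
  note [measurable_cong] = K(2) L(2)
  show ?thesis
    unfolding proposal_kernel_def by (rule prob_space_distr) measurable
qed

lemma prob_space_rcar_kernel:
  fixes K :: "'a::{banach, second_countable_topology} \<Rightarrow> 'a measure"
  assumes [measurable]: "\<Psi> \<in> borel_measurable borel" and "markov_kernel K" "radon_prob L"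
  shows "prob_space (rcar_kernel \<Psi> K L u)"
proof
  interpret Q: prob_space "proposal_kernel K L u"
    by (rule prob_space_proposal_kernel) fact+
  have sp: "space (rcar_kernel \<Psi> K L u) = UNIV"
    using sets_eq_imp_space_eq[OF sets_rcar_kernel, of \<Psi> K L u] by simp
  have "emeasure (rcar_kernel \<Psi> K L u) UNIV =
      (\<integral>\<^sup>+v. ennreal (acceptance \<Psi> u v) + ennreal (1 - acceptance \<Psi> u v) \<partial>proposal_kernel K L u)"
    by (subst emeasure_rcar_kernel) (auto simp: nn_integral_add)
  also have "\<dots> = (\<integral>\<^sup>+v. 1 \<partial>proposal_kernel K L u)"
    by (intro nn_integral_cong) (auto simp: acceptance_def simp flip: ennreal_plus)
  also have "\<dots> = 1"
    by (simp add: Q.emeasure_space_1)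
  finally show "emeasure (rcar_kernel \<Psi> K L u) (space (rcar_kernel \<Psi> K L u)) = 1"
    by (simp add: sp)
qed

end

theory Submission
  imports Defs
begin

text \<open>
  Write \<open>V u = \<parallel>u\<parallel>\<^sup>p\<close> and let the proposal be \<open>\<zeta> + \<xi>\<close> with independent \<open>\<zeta> \<sim> K u\<close> and \<open>\<xi> \<sim> L\<close>.
  One step of the chain ends at the proposal or stays at \<open>u\<close>, so its expected \<open>V\<close> is the mean over
  \<open>(\<zeta>, \<xi>)\<close> of a convex combination of \<open>V (\<zeta> + \<xi>)\<close> and \<open>V u\<close>
  (\<open>has_bochner_integral_rcar_kernel\<close>). Two bounds on that combination compete.

  Noise costs little. Since \<open>\<parallel>\<zeta>\<parallel> \<le> \<parallel>u\<parallel>\<close> almost surely, both values are at most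
  \<open>(\<parallel>u\<parallel> + \<parallel>\<xi>\<parallel>)\<^sup>p\<close>, which for every \<open>\<eta> > 0\<close> is at most \<open>(1 + \<eta>) V u + C \<parallel>\<xi>\<parallel>\<^sup>p\<close>
  (\<open>power_add_le_almost_power\<close>); the last term has a finite mean that does not depend on \<open>u\<close>.

  Contraction gains a fixed fraction of \<open>V u\<close>. Enlarge the concentration radius from
  \<open>b\<^sub>0 (1 - \<beta>) \<parallel>u\<parallel>\<close> to \<open>b (1 - \<beta>) \<parallel>u\<parallel>\<close> with \<open>b\<^sub>0 < b < 1\<close>. For large \<open>u\<close> the gap between the two
  radii exceeds the radius \<open>t\<close> of a ball that carries half the mass of \<open>L\<close>. Hence with probability at
  least \<open>\<epsilon> / 2\<close> the proposal lies in the larger ball around \<open>\<beta> u\<close>. There the acceptance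
  probability is at least some \<open>m > 0\<close> by the tail condition, and \<open>V (\<zeta> + \<xi>) \<le> \<theta> V u\<close> with
  \<open>\<theta> = (\<beta> + b (1 - \<beta>))\<^sup>p < 1\<close>, so \<open>V\<close> drops in the mean by at least \<open>m (1 - \<theta>) V u\<close>
  (\<open>mh_step_mean_decrease\<close>).

  On average the gain is thus at least \<open>\<gamma> V u\<close> with \<open>\<gamma> = m (1 - \<theta>) \<epsilon> / 2\<close>, and the choice \<open>\<eta> = \<gamma> / 2\<close> leaves the
  contraction factor \<open>1 - \<gamma> / 2\<close> outside a ball. Inside that ball the first bound is at most
  a constant.
\<close>

section \<open>Integration against the kernel\<close>

text \<open>Serves to integrate against the kernel, which is the sum of an absolutely continuous part (the
  accepted proposals) and an atom at the current state (the rejections).\<close>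

lemma nn_integral_add_measures:
  fixes f :: "'a \<Rightarrow> ennreal"
  assumes f: "f \<in> borel_measurable P"
    and [simp, measurable_cong]: "sets M = sets P" "sets N = sets P"
    and split: "\<And>A. A \<in> sets P \<Longrightarrow> emeasure P A = emeasure M A + emeasure N A"
  shows "(\<integral>\<^sup>+x. f x \<partial>P) = (\<integral>\<^sup>+x. f x \<partial>M) + (\<integral>\<^sup>+x. f x \<partial>N)"
proof -
  have sp: "space M = space P" "space N = space P"
    by (auto intro!: sets_eq_imp_space_eq)
  show ?thesis
    using f
  proof (induct rule: borel_measurable_induct)
    case (cong f g)
    have "(\<integral>\<^sup>+x. f x \<partial>P) = (\<integral>\<^sup>+x. g x \<partial>P)" "(\<integral>\<^sup>+x. f x \<partial>M) = (\<integral>\<^sup>+x. g x \<partial>M)"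
      "(\<integral>\<^sup>+x. f x \<partial>N) = (\<integral>\<^sup>+x. g x \<partial>N)"
      by (intro nn_integral_cong cong(3); simp add: sp)+
    with cong(4) show ?case by simp
  next
    case (set A)
    then show ?case by (simp add: split)
  next
    case (mult g c)
    then have [measurable]: "g \<in> borel_measurable P" by simp
    show ?case by (simp add: nn_integral_cmult mult distrib_left)
  next
    case (add g h)
    then have [measurable]: "g \<in> borel_measurable P" "h \<in> borel_measurable P" by simp_all
    show ?case by (simp add: nn_integral_add add ac_simps)
  next
    case (seq U)
    have [measurable]: "U i \<in> borel_measurable P" for i by (rule seq)
    have mono: "incseq (\<lambda>i. \<integral>\<^sup>+x. U i x \<partial>Q)" for Q :: "'a measure"
      using seq(4) by (auto simp: incseq_def le_fun_def intro!: nn_integral_mono)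
    have SUP: "(\<integral>\<^sup>+x. (SUP i. U i) x \<partial>Q) = (SUP i. \<integral>\<^sup>+x. U i x \<partial>Q)"
      if [measurable_cong]: "sets Q = sets P" for Q
      using nn_integral_monotone_convergence_SUP[OF seq(4), of Q]
      by (simp add: image_comp)
    show ?case
      by (simp only: SUP seq(3) refl \<open>sets M = sets P\<close> \<open>sets N = sets P\<close> ennreal_SUP_add[OF mono mono])
  qed
qed

text \<open>The expectation of \<open>V\<close> at the next state, given that \<open>v\<close> is proposed at \<open>u\<close>: only the
  accept/reject coin is averaged out.\<close>

definition mh_step_mean :: "('a \<Rightarrow> real) \<Rightarrow> ('a \<Rightarrow> real) \<Rightarrow> 'a \<Rightarrow> 'a \<Rightarrow> real" where
  "mh_step_mean \<Psi> V u v = acceptance \<Psi> u v * V v + (1 - acceptance \<Psi> u v) * V u"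

lemma acceptance_nonneg: "0 \<le> acceptance \<Psi> u v"
  and acceptance_le_1: "acceptance \<Psi> u v \<le> 1"
  by (auto simp: acceptance_def)

lemma mh_step_mean_nonneg: "(\<And>v. 0 \<le> V v) \<Longrightarrow> 0 \<le> mh_step_mean \<Psi> V u v"
  by (simp add: mh_step_mean_def acceptance_nonneg acceptance_le_1)

lemma borel_measurable_mh_step_mean [measurable]:
  assumes [measurable]: "\<Psi> \<in> borel_measurable borel" "V \<in> borel_measurable borel"
  shows "mh_step_mean \<Psi> V u \<in> borel_measurable borel"
  unfolding mh_step_mean_def by measurable

lemma nn_integral_rcar_kernel:
  assumes [measurable]: "\<Psi> \<in> borel_measurable borel" "V \<in> borel_measurable borel"
    and V: "\<And>v. 0 \<le> V v"
  shows "(\<integral>\<^sup>+v. ennreal (V v) \<partial>rcar_kernel \<Psi> K L u) =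
    (\<integral>\<^sup>+v. ennreal (mh_step_mean \<Psi> V u v) \<partial>proposal_kernel K L u)"
proof -
  let ?Q = "proposal_kernel K L u"
  let ?A = "density ?Q (\<lambda>v. ennreal (acceptance \<Psi> u v))"
  let ?c = "\<integral>\<^sup>+w. ennreal (1 - acceptance \<Psi> u w) \<partial>?Q"
  let ?R = "scale_measure ?c (return borel u)"
  have "(\<integral>\<^sup>+v. ennreal (V v) \<partial>rcar_kernel \<Psi> K L u) =
      (\<integral>\<^sup>+v. ennreal (V v) \<partial>?A) + (\<integral>\<^sup>+v. ennreal (V v) \<partial>?R)"
    by (rule nn_integral_add_measures)
       (auto simp: emeasure_rcar_kernel emeasure_density mult.commute)
  also have "\<dots> = (\<integral>\<^sup>+v. ennreal (acceptance \<Psi> u v) * ennreal (V v) \<partial>?Q) + ?c * ennreal (V u)"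
    by (simp add: nn_integral_density nn_integral_scale_measure nn_integral_return)
  also have "\<dots> = (\<integral>\<^sup>+v. ennreal (acceptance \<Psi> u v) * ennreal (V v)
      + ennreal (1 - acceptance \<Psi> u v) * ennreal (V u) \<partial>?Q)"
    by (simp add: nn_integral_add nn_integral_multc)
  also have "\<dots> = (\<integral>\<^sup>+v. ennreal (mh_step_mean \<Psi> V u v) \<partial>?Q)"
    by (intro nn_integral_cong)
       (simp add: mh_step_mean_def V acceptance_nonneg acceptance_le_1 ennreal_mult ennreal_plus)
  finally show ?thesis .
qed

text \<open>Stating integrability over \<open>K u\<close> and \<open>L\<close> reduces both clauses of a Lyapunov bound,
  integrability and the drift inequality, to estimates of one function of two independent variables.\<close>

lemma has_bochner_integral_rcar_kernel:
  fixes \<Psi> :: "'a::{banach, second_countable_topology} \<Rightarrow> real"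
  assumes [measurable]: "\<Psi> \<in> borel_measurable borel" "V \<in> borel_measurable borel"
    and [measurable_cong]: "sets (K u) = sets borel" "sets L = sets borel"
    and V: "\<And>v. 0 \<le> V v"
    and int: "integrable (K u \<Otimes>\<^sub>M L) (\<lambda>(\<zeta>, \<xi>). mh_step_mean \<Psi> V u (\<zeta> + \<xi>))"
  shows "has_bochner_integral (rcar_kernel \<Psi> K L u) V
    (\<integral>(\<zeta>, \<xi>). mh_step_mean \<Psi> V u (\<zeta> + \<xi>) \<partial>(K u \<Otimes>\<^sub>M L))"
proof (rule has_bochner_integral_nn_integral)
  have "(\<integral>\<^sup>+v. ennreal (V v) \<partial>rcar_kernel \<Psi> K L u) =
      (\<integral>\<^sup>+y. ennreal (case y of (\<zeta>, \<xi>) \<Rightarrow> mh_step_mean \<Psi> V u (\<zeta> + \<xi>)) \<partial>(K u \<Otimes>\<^sub>M L))"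
    unfolding nn_integral_rcar_kernel[OF assms(1,2) V] proposal_kernel_def
    by (subst nn_integral_distr) (auto simp: case_prod_beta)
  also have "\<dots> = ennreal (\<integral>(\<zeta>, \<xi>). mh_step_mean \<Psi> V u (\<zeta> + \<xi>) \<partial>(K u \<Otimes>\<^sub>M L))"
    using int by (intro nn_integral_eq_integral) (auto simp: mh_step_mean_nonneg V)
  finally show "(\<integral>\<^sup>+v. ennreal (V v) \<partial>rcar_kernel \<Psi> K L u) =
      ennreal (\<integral>(\<zeta>, \<xi>). mh_step_mean \<Psi> V u (\<zeta> + \<xi>) \<partial>(K u \<Otimes>\<^sub>M L))" .
qed (auto simp: V intro!: integral_nonneg_AE mh_step_mean_nonneg)

section \<open>Marginals and tightness\<close>

lemma distr_pair_snd:
  assumes "prob_space M" "prob_space N"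
  shows "distr (M \<Otimes>\<^sub>M N) N snd = N"
proof -
  interpret M: prob_space M by fact
  interpret N: prob_space N by fact
  show ?thesis
  proof (rule measure_eqI)
    fix A assume "A \<in> sets (distr (M \<Otimes>\<^sub>M N) N snd)"
    then have A: "A \<in> sets N" by simp
    then have "snd -` A \<inter> space (M \<Otimes>\<^sub>M N) = space M \<times> A"
      by (auto simp: space_pair_measure dest: sets.sets_into_space)
    with A show "emeasure (distr (M \<Otimes>\<^sub>M N) N snd) A = emeasure N A"
      by (simp add: emeasure_distr N.emeasure_pair_measure_Times M.emeasure_space_1)
  qed simp
qed

lemma ball_carries_half_mass:
  fixes L :: "'a::real_normed_vector measure"
  assumes "prob_space L" and sets [measurable_cong]: "sets L = sets borel"
  obtains t :: real where "0 \<le> t" "1/2 \<le> measure L (cball 0 t)"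
proof -
  interpret prob_space L by fact
  have sp: "space L = UNIV" using sets_eq_imp_space_eq[OF sets] by simp
  have "(\<lambda>n. measure L (cball 0 (real n))) \<longlonglongrightarrow> measure L (\<Union>n. cball 0 (real n))"
    by (rule finite_Lim_measure_incseq) (auto simp: sets incseq_def)
  also have "(\<Union>n. cball 0 (real n)) = (UNIV :: 'a set)"
    using real_arch_simple by auto
  finally have "(\<lambda>n. measure L (cball 0 (real n))) \<longlonglongrightarrow> 1"
    using prob_space by (simp add: sp)
  then have "\<forall>\<^sub>F n in sequentially. 1/2 < measure L (cball 0 (real n))"
    by (rule order_tendstoD) simp
  then obtain n where "1/2 < measure L (cball 0 (real n))"
    by (auto simp: eventually_sequentially)
  then show thesis by (intro that[of "real n"]) auto
qed

section \<open>The drift inequality for a single outcome\<close>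

text \<open>Either \<open>x\<close> is a small multiple of \<open>r\<close>, or \<open>r\<close> is a bounded multiple of \<open>x\<close>; the two terms
  on the right cover the two cases.\<close>

lemma power_add_le_weighted:
  fixes r x d :: real
  assumes "0 \<le> r" "0 \<le> x" "0 < d"
  shows "(r + x) ^ p \<le> (1 + d) ^ p * r ^ p + (1 + 1/d) ^ p * x ^ p"
proof (cases "x \<le> d * r")
  case True
  then have "(r + x) ^ p \<le> ((1 + d) * r) ^ p"
    using assms by (intro power_mono) (auto simp: algebra_simps)
  moreover have "0 \<le> (1 + 1/d) ^ p * x ^ p" using assms by simp
  ultimately show ?thesis unfolding power_mult_distrib by linarith
next
  case False
  then have "r \<le> x / d" using assms by (simp add: field_simps)
  then have "(r + x) ^ p \<le> ((1 + 1/d) * x) ^ p"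
    using assms by (intro power_mono) (auto simp: algebra_simps)
  moreover have "0 \<le> (1 + d) ^ p * r ^ p" using assms by simp
  ultimately show ?thesis unfolding power_mult_distrib by linarith
qed

text \<open>The factor in front of \<open>r\<^sup>p\<close> can be brought as close to 1 as desired, at the expense of the
  constant in front of \<open>x\<^sup>p\<close>. This is what lets an arbitrarily small contraction gain outweigh
  the noise.\<close>

lemma power_add_le_almost_power:
  fixes \<eta> :: real
  assumes "0 < \<eta>"
  obtains C where "0 \<le> C"
    "\<And>r x :: real. 0 \<le> r \<Longrightarrow> 0 \<le> x \<Longrightarrow> (r + x) ^ p \<le> (1 + \<eta>) * r ^ p + C * x ^ p"
proof -
  have "((\<lambda>d::real. (1 + d) ^ p) \<longlongrightarrow> (1 + 0) ^ p) (at_right 0)"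
    by (intro tendsto_intros)
  then have "\<forall>\<^sub>F d in at_right (0::real). (1 + d) ^ p < 1 + \<eta>"
    by (rule order_tendstoD) (use assms in simp)
  then have "\<forall>\<^sub>F d in at_right (0::real). (1 + d) ^ p < 1 + \<eta> \<and> 0 < d"
    by (intro eventually_conj eventually_at_right_less)
  then obtain d :: real where d: "(1 + d) ^ p < 1 + \<eta>" "0 < d"
    using eventually_happens'[OF trivial_limit_at_right_real] by blast
  show thesis
  proof (rule that[of "(1 + 1/d) ^ p"])
    fix r x :: real assume "0 \<le> r" "0 \<le> x"
    then have "(1 + d) ^ p * r ^ p \<le> (1 + \<eta>) * r ^ p"
      using d by (intro mult_right_mono) auto
    with power_add_le_weighted[OF \<open>0 \<le> r\<close> \<open>0 \<le> x\<close> d(2), of p]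
    show "(r + x) ^ p \<le> (1 + \<eta>) * r ^ p + (1 + 1/d) ^ p * x ^ p" by linarith
  qed (use d in simp)
qed

lemma mh_step_mean_le:
  assumes "V v \<le> B" "V u \<le> B"
  shows "mh_step_mean \<Psi> V u v \<le> B"
  unfolding mh_step_mean_def
  using assms convex_bound_le[of "V v" B "V u" "acceptance \<Psi> u v" "1 - acceptance \<Psi> u v"]
  by (simp add: acceptance_nonneg acceptance_le_1)

text \<open>Rejection leaves \<open>V u\<close> unchanged and acceptance removes at least \<open>(1 - \<theta>) V u\<close>, so a lower
  bound on the acceptance probability turns into a relative decrease.\<close>

lemma mh_step_mean_decrease:
  assumes "V v \<le> \<theta> * V u" "\<theta> \<le> 1" "0 \<le> V u" "m \<le> acceptance \<Psi> u v"
  shows "mh_step_mean \<Psi> V u v \<le> (1 - m * (1 - \<theta>)) * V u"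
proof -
  let ?a = "acceptance \<Psi> u v"
  have "mh_step_mean \<Psi> V u v \<le> ?a * (\<theta> * V u) + (1 - ?a) * V u"
    unfolding mh_step_mean_def using assms acceptance_nonneg[of \<Psi> u v] acceptance_le_1[of \<Psi> u v]
    by (intro add_mono mult_left_mono) auto
  also have "\<dots> = V u - ?a * ((1 - \<theta>) * V u)" by (simp add: algebra_simps)
  also have "\<dots> \<le> V u - m * ((1 - \<theta>) * V u)"
    using assms by (intro diff_left_mono mult_right_mono) auto
  finally show ?thesis by (simp add: algebra_simps)
qed

section \<open>Integrating the drift inequality\<close>

text \<open>The weak bound \<open>A + C \<parallel>\<xi>\<parallel>\<^sup>p\<close> holds for almost every outcome and is improved by \<open>g\<close> on the
  event \<open>\<zeta> \<in> B, \<xi> \<in> D\<close>, whose probability factorizes by independence. Taking \<open>B\<close> and \<open>D\<close> empty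
  gives the bound for states near the origin, where no decrease is available.\<close>

lemma rcar_kernel_norm_power_bound:
  fixes \<Psi> :: "'a::{banach, second_countable_topology} \<Rightarrow> real"
  assumes [measurable]: "\<Psi> \<in> borel_measurable borel"
    and "prob_space (K u)" "prob_space L"
    and sets [measurable_cong]: "sets (K u) = sets borel" "sets L = sets borel"
    and le: "AE \<zeta> in K u. norm \<zeta> \<le> norm u"
    and mom: "integrable L (\<lambda>\<xi>. norm \<xi> ^ p)"
    and C: "\<And>x. 0 \<le> x \<Longrightarrow> (norm u + x) ^ p \<le> A + C * x ^ p" "0 \<le> C"
    and [measurable]: "B \<in> sets borel" "D \<in> sets borel"
    and drop: "\<And>\<zeta> \<xi>. \<zeta> \<in> B \<Longrightarrow> \<xi> \<in> D \<Longrightarrow> mh_step_mean \<Psi> (\<lambda>v. norm v ^ p) u (\<zeta> + \<xi>) \<le> A - g"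
  shows "integrable (rcar_kernel \<Psi> K L u) (\<lambda>v. norm v ^ p)"
    and "(\<integral>v. norm v ^ p \<partial>rcar_kernel \<Psi> K L u) \<le>
      A + C * (\<integral>\<xi>. norm \<xi> ^ p \<partial>L) - g * (measure (K u) B * measure L D)"
proof -
  interpret K: prob_space "K u" by fact
  interpret L: prob_space L by fact
  interpret P: pair_prob_space "K u" L ..
  let ?V = "\<lambda>v::'a. norm v ^ p"
  let ?f = "\<lambda>(\<zeta>, \<xi>). mh_step_mean \<Psi> ?V u (\<zeta> + \<xi>)"
  let ?h = "\<lambda>y. A + C * norm (snd y) ^ p - g * indicator (B \<times> D) y"
  have "AE y in K u \<Otimes>\<^sub>M L. norm (fst y) \<le> norm u"
  proof (rule AE_distrD[where M' = "K u" and f = fst])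
    show "AE \<zeta> in distr (K u \<Otimes>\<^sub>M L) (K u) fst. norm \<zeta> \<le> norm u"
      using le by (simp only: L.distr_pair_fst)
  qed measurable
  then have bound: "AE y in K u \<Otimes>\<^sub>M L. ?f y \<le> ?h y"
  proof (rule AE_mp, intro AE_I2 impI)
    fix y :: "'a \<times> 'a" assume y: "norm (fst y) \<le> norm u"
    obtain \<zeta> \<xi> where [simp]: "y = (\<zeta>, \<xi>)" by (cases y)
    show "?f y \<le> ?h y"
    proof (cases "\<zeta> \<in> B \<and> \<xi> \<in> D")
      case True
      moreover have "0 \<le> C * norm \<xi> ^ p" using C(2) by simp
      ultimately show ?thesis using drop[of \<zeta> \<xi>] by (simp add: indicator_def)
    next
      case False
      have "norm (\<zeta> + \<xi>) \<le> norm u + norm \<xi>"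
        using y norm_triangle_ineq[of \<zeta> \<xi>] by simp
      then have "norm (\<zeta> + \<xi>) ^ p \<le> (norm u + norm \<xi>) ^ p"
        by (intro power_mono) auto
      moreover have "norm u ^ p \<le> (norm u + norm \<xi>) ^ p"
        by (intro power_mono) auto
      ultimately have "mh_step_mean \<Psi> ?V u (\<zeta> + \<xi>) \<le> A + C * norm \<xi> ^ p"
        using C(1)[of "norm \<xi>"] by (intro mh_step_mean_le) auto
      with False show ?thesis by (auto simp: indicator_def)
    qed
  qed
  have snd: "integrable (K u \<Otimes>\<^sub>M L) (\<lambda>y. norm (snd y) ^ p)"
    "(\<integral>y. norm (snd y) ^ p \<partial>(K u \<Otimes>\<^sub>M L)) = (\<integral>\<xi>. norm \<xi> ^ p \<partial>L)"
    using mom distr_pair_snd[OF \<open>prob_space (K u)\<close> \<open>prob_space L\<close>]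
      integrable_distr_eq[of snd "K u \<Otimes>\<^sub>M L" L "\<lambda>\<xi>. norm \<xi> ^ p"]
      integral_distr[of snd "K u \<Otimes>\<^sub>M L" L "\<lambda>\<xi>. norm \<xi> ^ p"] by auto
  have BD: "B \<times> D \<in> sets (K u \<Otimes>\<^sub>M L)" by (intro pair_measureI) (auto simp: sets)
  have ind: "integrable (K u \<Otimes>\<^sub>M L) (indicator (B \<times> D) :: _ \<Rightarrow> real)"
    using BD by (simp add: P.emeasure_eq_measure)
  have h: "integrable (K u \<Otimes>\<^sub>M L) ?h"
    using snd(1) ind by (intro Bochner_Integration.integrable_diff Bochner_Integration.integrable_add integrable_mult_right) auto
  have f: "integrable (K u \<Otimes>\<^sub>M L) ?f"
  proof (rule Bochner_Integration.integrable_bound[OF h])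
    show "AE y in K u \<Otimes>\<^sub>M L. norm (?f y) \<le> norm (?h y)"
      using bound
    proof (rule AE_mp, intro AE_I2 impI)
      fix y assume "?f y \<le> ?h y"
      moreover have "0 \<le> ?f y" by (cases y) (simp add: mh_step_mean_nonneg)
      ultimately show "norm (?f y) \<le> norm (?h y)" by simp
    qed
  qed measurable
  have "measure (K u \<Otimes>\<^sub>M L) (B \<times> D) = measure (K u) B * measure L D"
    using L.emeasure_pair_measure_Times[of B "K u" D] by (simp add: sets measure_def enn2real_mult)
  then have "(\<integral>y. ?h y \<partial>(K u \<Otimes>\<^sub>M L)) =
      A + C * (\<integral>\<xi>. norm \<xi> ^ p \<partial>L) - g * (measure (K u) B * measure L D)"
    using snd ind sets.sets_into_space[OF BD] P.prob_space by (simp add: Int_absorb2)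
  with integral_mono_AE[OF f h bound] have le': "(\<integral>y. ?f y \<partial>(K u \<Otimes>\<^sub>M L)) \<le>
      A + C * (\<integral>\<xi>. norm \<xi> ^ p \<partial>L) - g * (measure (K u) B * measure L D)" by simp
  have "has_bochner_integral (rcar_kernel \<Psi> K L u) ?V (\<integral>y. ?f y \<partial>(K u \<Otimes>\<^sub>M L))"
    by (rule has_bochner_integral_rcar_kernel) (use f sets in auto)
  then show "integrable (rcar_kernel \<Psi> K L u) ?V"
    "(\<integral>v. norm v ^ p \<partial>rcar_kernel \<Psi> K L u) \<le>
      A + C * (\<integral>\<xi>. norm \<xi> ^ p \<partial>L) - g * (measure (K u) B * measure L D)"
    using le' by (auto simp: has_bochner_integral_iff)
qed

section \<open>The Lyapunov property\<close>

text \<open>The infimum in the tail condition is a true lower bound because the exponential is bounded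
  below; without that, the infimum over reals would carry no information.\<close>

lemma acceptance_ge_of_INF:
  assumes "M \<le> (INF v\<in>S. exp (\<Psi> u - \<Psi> v))" "v \<in> S"
  shows "min 1 M \<le> acceptance \<Psi> u v"
proof -
  have "(INF v\<in>S. exp (\<Psi> u - \<Psi> v)) \<le> exp (\<Psi> u - \<Psi> v)"
    using assms(2) by (intro cINF_lower bdd_belowI2[of _ 0]) auto
  with assms(1) show ?thesis unfolding acceptance_def by (intro min.mono) auto
qed

theorem theorem1:
  fixes \<Psi> :: "'a::{banach, second_countable_topology} \<Rightarrow> real"
    and K :: "'a \<Rightarrow> 'a measure"
    and L :: "'a measure"
    and p :: nat
  assumes "\<Psi> \<in> borel_measurable borel"
    and "markov_kernel K"
    and "radon_prob L"
    and increasing_in_tail: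
      "\<forall>\<beta> b :: real. 0 < \<beta> \<and> \<beta> < 1 \<and> 0 < b \<and> b < 1 \<longrightarrow>
         (\<exists>R\<^sub>0 M\<^sub>4. 0 < R\<^sub>0 \<and> 0 < M\<^sub>4 \<and> (\<forall>u. norm u > R\<^sub>0 \<longrightarrow>
           (INF v\<in>cball (\<beta> *\<^sub>R u) (b * (1 - \<beta>) * norm u). exp (\<Psi> u - \<Psi> v)) \<ge> M\<^sub>4))"
    and contraction: "\<forall>u. u \<noteq> 0 \<longrightarrow> (AE \<zeta> in K u. norm \<zeta> < norm u)"
    and contraction_0: "AE \<zeta> in K 0. \<zeta> = 0"
    and local_concentration:
      "\<exists>b\<^sub>0 \<beta>\<^sub>0 \<epsilon>\<^sub>0 :: real. 0 < b\<^sub>0 \<and> b\<^sub>0 < \<beta>\<^sub>0 \<and> \<beta>\<^sub>0 < 1 \<and> 0 < \<epsilon>\<^sub>0 \<and>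
         (\<forall>u. measure (K u) {\<zeta>. norm (\<zeta> - \<beta>\<^sub>0 *\<^sub>R u) \<le> b\<^sub>0 * (1 - \<beta>\<^sub>0) * norm u} \<ge> \<epsilon>\<^sub>0)"
    and "p \<ge> 1"
    and "integrable L (\<lambda>\<xi>. norm \<xi> ^ p)"
  shows "lyapunov_function (rcar_kernel \<Psi> K L) (\<lambda>u. norm u ^ p)"
proof -
  let ?V = "\<lambda>v::'a. norm v ^ p"
  have K: "prob_space (K u)" "sets (K u) = sets borel" for u
    using measurable_space[OF assms(2)[unfolded markov_kernel_def], of u]
    by (auto simp: space_prob_algebra)
  have L: "prob_space L" "sets L = sets borel"
    using assms(3) by (auto simp: radon_prob_def)
  have nonexpansive: "AE \<zeta> in K u. norm \<zeta> \<le> norm u" for u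
  proof (cases "u = 0")
    case True
    show ?thesis using contraction_0 unfolding True by eventually_elim simp
  next
    case False
    with contraction have "AE \<zeta> in K u. norm \<zeta> < norm u" by simp
    then show ?thesis by eventually_elim simp
  qed
  obtain b\<^sub>0 \<beta> \<epsilon> :: real where b0: "0 < b\<^sub>0" "b\<^sub>0 < \<beta>" "\<beta> < 1" "0 < \<epsilon>"
    and conc: "\<And>u. \<epsilon> \<le> measure (K u) {\<zeta>. norm (\<zeta> - \<beta> *\<^sub>R u) \<le> b\<^sub>0 * (1 - \<beta>) * norm u}"
    using local_concentration by blast
  define b where "b = (1 + b\<^sub>0) / 2"
  have b: "0 < b" "b < 1" "b\<^sub>0 < b" using b0 by (auto simp: b_def)
  obtain R\<^sub>0 M where "0 < R\<^sub>0" "0 < M"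
    and tail: "\<And>u. R\<^sub>0 < norm u \<Longrightarrow>
      M \<le> (INF v\<in>cball (\<beta> *\<^sub>R u) (b * (1 - \<beta>) * norm u). exp (\<Psi> u - \<Psi> v))"
    using increasing_in_tail[rule_format, of \<beta> b] b b0 by auto
  obtain t where t: "0 \<le> t" "1/2 \<le> measure L (cball 0 t)"
    using ball_carries_half_mass[OF L] .
  \<comment> \<open>Once \<open>\<parallel>u\<parallel>\<close> exceeds the second argument of the maximum, noise of size \<open>t\<close>
    fits into the gap between the two balls around \<open>\<beta> u\<close>.\<close>
  define R where "R = max R\<^sub>0 (t / ((b - b\<^sub>0) * (1 - \<beta>)))"
  define \<theta> where "\<theta> = (\<beta> + b * (1 - \<beta>)) ^ p"
  define m where "m = min 1 M"
  define \<gamma> where "\<gamma> = m * (1 - \<theta>) * (\<epsilon> / 2)"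
  have "0 < (1 - b) * (1 - \<beta>)" using b b0 by simp
  then have "\<beta> + b * (1 - \<beta>) < 1" by (simp add: algebra_simps)
  then have \<theta>: "0 \<le> \<theta>" "\<theta> < 1"
    unfolding \<theta>_def using b b0 \<open>p \<ge> 1\<close>
    by (auto intro!: power_less_one_iff[THEN iffD2] add_nonneg_nonneg)
  have m: "0 < m" "m \<le> 1" using \<open>0 < M\<close> by (auto simp: m_def)
  \<comment> \<open>The gain cannot exceed the whole of \<open>V u\<close>; this keeps the contraction factor positive.\<close>
  have "\<epsilon> \<le> 1"
    using conc[of 0] prob_space.prob_le_1[OF K(1)] by (rule order_trans)
  have "m * (1 - \<theta>) * (\<epsilon> / 2) \<le> 1 * (1/2)"
    using m \<theta> \<open>\<epsilon> \<le> 1\<close> b0 by (intro mult_mono mult_le_one) auto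
  moreover have "0 < \<gamma>" unfolding \<gamma>_def using m \<theta> b0 by simp
  ultimately have \<gamma>: "0 < \<gamma>" "\<gamma> \<le> 1/2" by (simp_all add: \<gamma>_def)
  obtain C where C: "0 \<le> C"
    "\<And>r x :: real. 0 \<le> r \<Longrightarrow> 0 \<le> x \<Longrightarrow> (r + x) ^ p \<le> (1 + \<gamma> / 2) * r ^ p + C * x ^ p"
    using power_add_le_almost_power[of "\<gamma> / 2" p] \<gamma> by auto
  define E where "E = (\<integral>\<xi>. norm \<xi> ^ p \<partial>L)"
  have "0 \<le> C * E" unfolding E_def using C(1) by (intro mult_nonneg_nonneg integral_nonneg_AE) auto
  have R: "0 \<le> R" unfolding R_def using \<open>0 < R\<^sub>0\<close> by simp
  have bound: "integrable (rcar_kernel \<Psi> K L u) ?V"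
    "(\<integral>v. ?V v \<partial>rcar_kernel \<Psi> K L u) \<le>
      (1 + \<gamma> / 2) * ?V u + C * E - g * (measure (K u) B * measure L D)"
    if "B \<in> sets borel" "D \<in> sets borel"
      "\<And>\<zeta> \<xi>. \<zeta> \<in> B \<Longrightarrow> \<xi> \<in> D \<Longrightarrow>
        mh_step_mean \<Psi> ?V u (\<zeta> + \<xi>) \<le> (1 + \<gamma> / 2) * ?V u - g"
    for u g B D
    unfolding E_def
    using rcar_kernel_norm_power_bound[where \<Psi> = \<Psi> and K = K and u = u and L = L and p = p
        and A = "(1 + \<gamma> / 2) * ?V u" and C = C and B = B and D = D and g = g,
        OF assms(1) K(1) L(1) K(2) L(2) nonexpansive assms(9) C(2)[OF norm_ge_zero] C(1)] that
    by blast+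
  have far: "(\<integral>v. ?V v \<partial>rcar_kernel \<Psi> K L u) \<le> (1 - \<gamma> / 2) * ?V u + C * E"
    if u: "R < norm u" for u
  proof -
    let ?B = "{\<zeta>. norm (\<zeta> - \<beta> *\<^sub>R u) \<le> b\<^sub>0 * (1 - \<beta>) * norm u}"
    have t_le: "t \<le> (b - b\<^sub>0) * (1 - \<beta>) * norm u"
    proof -
      have "0 < (b - b\<^sub>0) * (1 - \<beta>)" using b b0 by simp
      moreover have "t / ((b - b\<^sub>0) * (1 - \<beta>)) \<le> norm u" using u by (simp add: R_def)
      ultimately show ?thesis by (simp only: pos_divide_le_eq mult.commute)
    qed
    have drop: "mh_step_mean \<Psi> ?V u (\<zeta> + \<xi>) \<le> (1 + \<gamma> / 2) * ?V u - m * (1 - \<theta>) * ?V u"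
      if "\<zeta> \<in> ?B" "\<xi> \<in> cball 0 t" for \<zeta> \<xi>
    proof -
      have "norm (\<zeta> + \<xi> - \<beta> *\<^sub>R u) \<le> norm (\<zeta> - \<beta> *\<^sub>R u) + norm \<xi>"
        using norm_triangle_ineq[of "\<zeta> - \<beta> *\<^sub>R u" \<xi>] by (simp add: algebra_simps)
      also have "\<dots> \<le> b\<^sub>0 * (1 - \<beta>) * norm u + (b - b\<^sub>0) * (1 - \<beta>) * norm u"
        using that t_le by simp
      also have "\<dots> = b * (1 - \<beta>) * norm u" by (simp add: algebra_simps)
      finally have close: "norm (\<zeta> + \<xi> - \<beta> *\<^sub>R u) \<le> b * (1 - \<beta>) * norm u" .
      then have "\<zeta> + \<xi> \<in> cball (\<beta> *\<^sub>R u) (b * (1 - \<beta>) * norm u)"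
        by (simp add: dist_norm norm_minus_commute)
      moreover have "R\<^sub>0 < norm u" using u by (simp add: R_def)
      ultimately have acc: "m \<le> acceptance \<Psi> u (\<zeta> + \<xi>)"
        unfolding m_def using tail by (intro acceptance_ge_of_INF)
      have "norm (\<zeta> + \<xi>) \<le> norm (\<beta> *\<^sub>R u) + norm (\<zeta> + \<xi> - \<beta> *\<^sub>R u)"
        using norm_triangle_ineq[of "\<beta> *\<^sub>R u" "\<zeta> + \<xi> - \<beta> *\<^sub>R u"] by simp
      also have "\<dots> \<le> (\<beta> + b * (1 - \<beta>)) * norm u"
        using close b0 by (simp add: algebra_simps)
      finally have "?V (\<zeta> + \<xi>) \<le> ((\<beta> + b * (1 - \<beta>)) * norm u) ^ p"
        by (intro power_mono) auto
      then have "?V (\<zeta> + \<xi>) \<le> \<theta> * ?V u" by (simp add: \<theta>_def power_mult_distrib)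
      then have "mh_step_mean \<Psi> ?V u (\<zeta> + \<xi>) \<le> (1 - m * (1 - \<theta>)) * ?V u"
        using \<theta> acc by (intro mh_step_mean_decrease) auto
      moreover have "0 \<le> \<gamma> / 2 * ?V u" using \<gamma> by simp
      ultimately show ?thesis unfolding left_diff_distrib distrib_right by simp
    qed
    have "\<epsilon> * (1/2) \<le> measure (K u) ?B * measure L (cball 0 t)"
      using conc t b0 by (intro mult_mono) auto
    then have "m * (1 - \<theta>) * ?V u * (\<epsilon> * (1/2)) \<le>
        m * (1 - \<theta>) * ?V u * (measure (K u) ?B * measure L (cball 0 t))"
      using m \<theta> by (intro mult_left_mono) auto
    moreover have "m * (1 - \<theta>) * ?V u * (\<epsilon> * (1/2)) = \<gamma> * ?V u"
      by (simp add: \<gamma>_def)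
    moreover have "(\<integral>v. ?V v \<partial>rcar_kernel \<Psi> K L u) \<le> (1 + \<gamma> / 2) * ?V u + C * E -
        m * (1 - \<theta>) * ?V u * (measure (K u) ?B * measure L (cball 0 t))"
      by (rule bound(2)) (use drop in auto)
    ultimately show ?thesis unfolding left_diff_distrib distrib_right by linarith
  qed
  have near: "(\<integral>v. ?V v \<partial>rcar_kernel \<Psi> K L u) \<le> 2 * R ^ p + C * E" if "norm u \<le> R" for u
  proof -
    have "(\<integral>v. ?V v \<partial>rcar_kernel \<Psi> K L u) \<le> (1 + \<gamma> / 2) * ?V u + C * E"
      using bound(2)[of "{}" "{}" u 0] by simp
    also have "(1 + \<gamma> / 2) * ?V u \<le> 2 * R ^ p"
      using that \<gamma> by (intro mult_mono power_mono) auto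
    finally show ?thesis by simp
  qed
  show ?thesis
    unfolding lyapunov_function_def
  proof (rule exI[of _ "1 - \<gamma> / 2"], rule exI[of _ "2 * R ^ p + C * E + 1"], intro conjI allI)
    show "0 < 2 * R ^ p + C * E + 1"
      using R \<open>0 \<le> C * E\<close> by (intro add_nonneg_pos add_nonneg_nonneg) auto
    fix u
    show "integrable (rcar_kernel \<Psi> K L u) ?V"
      by (rule bound(1)[of "{}" "{}" u 0]) auto
    have "0 \<le> (1 - \<gamma> / 2) * ?V u" "0 \<le> R ^ p" using \<gamma> R by auto
    then show "(\<integral>v. ?V v \<partial>rcar_kernel \<Psi> K L u) \<le> (1 - \<gamma> / 2) * ?V u + (2 * R ^ p + C * E + 1)"
      using far[of u] near[of u] by (cases "norm u \<le> R") auto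
  qed (use \<gamma> in auto)
qed

end
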